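(* Let $K\subset\mathbb R^n$ be a convex polyhedral cone, $A:\mathbb R^n\to\mathbb R^n$ linear, and $\Phi(x)=Ax+N(K,x)$. If $\Phi$ is metrically regular near $(0,0)$, i.e. there are $\kappa>0,\varepsilon>0$ with $d(x,\Phi^{-1}(y))\le\kappa\,d(y,\Phi(x))$ whenever $\|x\|<\varepsilon$, $\|y\|<\varepsilon$, then $A(K)\cap K^\circ=\{0\}$.
   Context: A convex polyhedral cone is a finite intersection of closed half-spaces $\{x:\langle a,x\rangle\le0\}$. $N(C,x)=\{y:\langle y,u-x\rangle\le0\ \forall u\in C\}$ for $x\in C$ and $N(C,x)=\emptyset$ for $x\notin C$. $K^\circ=\{y:\langle y,x\rangle\le0\ \forall x\in K\}$. $d(\cdot,\emptyset)=+\infty$. *)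

theory Defs
  imports "HOL-Analysis.Analysis"
begin

definition polyhedral_cone :: "'a::euclidean_space set \<Rightarrow> bool" where
  "polyhedral_cone K \<longleftrightarrow> (\<exists>F. finite F \<and> K = {x. \<forall>a\<in>F. inner a x \<le> 0})"

definition normal_cone :: "'a::euclidean_space set \<Rightarrow> 'a \<Rightarrow> 'a set" where
  "normal_cone C x = (if x \<in> C then {y. \<forall>u\<in>C. inner y (u - x) \<le> 0} else {})"

definition polar_cone :: "'a::euclidean_space set \<Rightarrow> 'a set" where
  "polar_cone K = {y. \<forall>x\<in>K. inner y x \<le> 0}"

definition set_dist :: "'a::euclidean_space \<Rightarrow> 'a set \<Rightarrow> ereal" where
  "set_dist x S = (if S = {} then \<infinity> else ereal (infdist x S))"

end

theory Submission
  imports Defs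
begin

text \<open>Metric regularity passes from \<open>K\<close> to the tangent cones \<open>K + \<real>e\<close> with \<open>e \<in> K\<close> and to the faces
  \<open>K \<inter> q\<^sup>\<bottom>\<close> with \<open>q \<in> K\<degree>\<close>, and each of these operations, when it changes the cone, lowers
  \<open>dim K + dim K\<degree>\<close>. So assume inductively that \<open>p \<in> K\<close>, \<open>A p \<in> K\<degree>\<close> forces \<open>p = 0\<close> for the smaller
  cones, and let \<open>x \<noteq> 0\<close> be such a point for \<open>K\<close>. Then no such point \<open>p \<noteq> 0\<close> lies on a proper face, and
  \<open>A p\<close> is orthogonal only to the lineality space of \<open>K\<close>. Solving \<open>-A x \<in> \<Phi>(z)\<close> and putting
  \<open>u = x + z\<close> gives \<open>u \<in> K\<close> with \<open>-A u \<in> K\<degree>\<close>, so \<open>A (x - t u) \<in> K\<degree>\<close> for all \<open>t \<ge> 0\<close>. The ray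
  \<open>x - t u\<close> can leave \<open>K\<close> only through a proper face, hence only at \<open>0\<close>; whether it leaves or not,
  \<open>K\<close> turns out to be a subspace, where the claim is a dimension count.\<close>

section \<open>Polyhedral cones, polars and normal cones\<close>

lemma polyhedral_coneE:
  assumes "polyhedral_cone K"
  obtains F where "finite F" "K = {x. \<forall>a\<in>F. inner a x \<le> 0}" "F \<subseteq> polar_cone K"
  using assms by (auto simp: polyhedral_cone_def polar_cone_def)

lemma polyhedral_cone_add:
  assumes "polyhedral_cone K" "x \<in> K" "y \<in> K"
  shows "x + y \<in> K"
  using assms by (fastforce simp: polyhedral_cone_def inner_add_right intro: add_nonpos_nonpos)

lemma polyhedral_cone_scaleR:
  assumes "polyhedral_cone K" "x \<in> K" "0 \<le> c"
  shows "c *\<^sub>R x \<in> K"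
  using assms by (auto simp: polyhedral_cone_def mult_nonneg_nonpos)

lemma polyhedral_cone_0:
  assumes "polyhedral_cone K"
  shows "0 \<in> K"
  using assms by (auto simp: polyhedral_cone_def)

lemma polar_cone_le: "q \<in> polar_cone K \<Longrightarrow> x \<in> K \<Longrightarrow> inner q x \<le> 0"
  by (auto simp: polar_cone_def)

text \<open>No separation argument is required: the normals that define \<open>K\<close> already lie
  in its polar, so the bipolar satisfies the same inequalities.\<close>

lemma polar_polar_cone:
  assumes "polyhedral_cone K"
  shows "polar_cone (polar_cone K) = K"
proof -
  obtain F where "K = {x. \<forall>a\<in>F. inner a x \<le> 0}" "F \<subseteq> polar_cone K"
    using assms by (rule polyhedral_coneE)
  then show ?thesis
    by (fastforce simp: polar_cone_def inner_commute)
qed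

text \<open>Farkas' lemma. A point outside the closed hull is strictly separated from it, and the
  negated separating vector lies in the cone but is positive on the point.\<close>

lemma polar_cone_eq_convex_cone_hull:
  fixes F :: "'a::euclidean_space set"
  assumes "finite F"
  shows "polar_cone {x. \<forall>a\<in>F. inner a x \<le> 0} = convex_cone hull F"
proof
  let ?K = "{x. \<forall>a\<in>F. inner a x \<le> 0}"
  have "convex_cone (polar_cone ?K)"
    by (auto simp: convex_cone_iff polar_cone_def inner_add_left mult_nonneg_nonpos
        intro: add_nonpos_nonpos)
  then show "convex_cone hull F \<subseteq> polar_cone ?K"
    by (intro hull_minimal) (auto simp: polar_cone_def)
  show "polar_cone ?K \<subseteq> convex_cone hull F"
  proof
    fix z assume z: "z \<in> polar_cone ?K"
    show "z \<in> convex_cone hull F"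
    proof (rule ccontr)
      assume "z \<notin> convex_cone hull F"
      then obtain a b where ab: "inner a z < b" "\<And>x. x \<in> convex_cone hull F \<Longrightarrow> b < inner a x"
        using separating_hyperplane_closed_point[of "convex_cone hull F" z]
          closed_convex_cone_hull[OF assms] convex_convex_cone_hull by blast
      have "b < 0"
        using ab(2)[OF convex_cone_hull_contains_0] by simp
      have "0 \<le> inner a f" if "f \<in> F" for f
      proof (rule ccontr)
        assume "\<not> 0 \<le> inner a f"
        then have neg: "inner a f < 0" by simp
        \<comment> \<open>This multiple of \<open>f\<close> has inner product exactly
          \<open>b\<close> with \<open>a\<close>, against the strict bound on the hull.\<close>
        have "(b / inner a f) *\<^sub>R f \<in> convex_cone hull F"
          using that neg \<open>b < 0\<close>
          by (intro convex_cone_hull_mul hull_inc) (auto simp: divide_nonpos_neg)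
        from ab(2)[OF this] neg show False by simp
      qed
      then have "- a \<in> ?K"
        by (auto simp: inner_commute)
      with z have "inner z (- a) \<le> 0"
        by (rule polar_cone_le)
      with ab(1) \<open>b < 0\<close> show False
        by (simp add: inner_commute)
    qed
  qed
qed

text \<open>Since \<open>0 \<in> K\<close>, every right-hand side \<open>c h\<close> is nonnegative;
  since \<open>K\<close> is closed under scaling, it can be replaced by \<open>0\<close>.\<close>

lemma polyhedral_cone_if_polyhedron:
  fixes K :: "'a::euclidean_space set"
  assumes "polyhedron K" "convex_cone K"
  shows "polyhedral_cone K"
proof -
  obtain \<H> where H: "finite \<H>" "K = \<Inter> \<H>" "\<forall>h\<in>\<H>. \<exists>a b. a \<noteq> 0 \<and> h = {x. inner a x \<le> b}"
    using assms(1) unfolding polyhedron_def by blast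
  then obtain n c where nc: "\<And>h. h \<in> \<H> \<Longrightarrow> h = {x. inner (n h) x \<le> c h}"
    by metis
  have "K = {x. \<forall>a\<in>n ` \<H>. inner a x \<le> 0}"
  proof (intro equalityI subsetI)
    fix x assume x: "x \<in> K"
    have "inner (n h) x \<le> 0" if "h \<in> \<H>" for h
    proof (rule ccontr)
      assume "\<not> inner (n h) x \<le> 0"
      then have pos: "0 < inner (n h) x" by simp
      define t where "t = (\<bar>c h\<bar> + 1) / inner (n h) x"
      have "t *\<^sub>R x \<in> K"
        using x pos assms(2) by (intro convex_cone_scaleR) (auto simp: t_def)
      then have "inner (n h) (t *\<^sub>R x) \<le> c h"
        using H(2) nc[OF that] that by blast
      with pos show False by (simp add: t_def)
    qed
    then show "x \<in> {x. \<forall>a\<in>n ` \<H>. inner a x \<le> 0}" by simp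
  next
    fix x assume x: "x \<in> {x. \<forall>a\<in>n ` \<H>. inner a x \<le> 0}"
    have "0 \<in> K" using assms(2) by (rule convex_cone_contains_0)
    have "x \<in> h" if "h \<in> \<H>" for h
    proof -
      have "0 \<in> h" using \<open>0 \<in> K\<close> H(2) that by auto
      then have "0 \<in> {x. inner (n h) x \<le> c h}" using nc[OF that] by blast
      then have "0 \<le> c h" by simp
      moreover have "inner (n h) x \<le> 0" using x that by auto
      ultimately have "inner (n h) x \<le> c h" by linarith
      then have "x \<in> {x. inner (n h) x \<le> c h}" by simp
      then show ?thesis using nc[OF that] by blast
    qed
    then show "x \<in> K" using H(2) by auto
  qed
  then show ?thesis
    unfolding polyhedral_cone_def using H(1) by (intro exI[of _ "n ` \<H>"]) auto
qed

text \<open>Minkowski-Weyl: the polar is finitely generated, hence polyhedral. The results on rays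
  thereby apply to the polar too.\<close>

lemma polyhedral_cone_polar_cone:
  assumes "polyhedral_cone K"
  shows "polyhedral_cone (polar_cone K)"
proof -
  obtain F where "finite F" "K = {x. \<forall>a\<in>F. inner a x \<le> 0}"
    using assms by (auto simp: polyhedral_cone_def)
  then show ?thesis
    by (simp add: polar_cone_eq_convex_cone_hull polyhedral_cone_if_polyhedron
        polyhedron_convex_cone_hull convex_cone_convex_cone_hull)
qed

text \<open>The test points \<open>0\<close> and \<open>x + x\<close> force orthogonality to
  \<open>x\<close>; what remains is the polar inequality.\<close>

lemma normal_cone_eq_polar_cone:
  assumes "polyhedral_cone K" "x \<in> K"
  shows "normal_cone K x = {v \<in> polar_cone K. inner v x = 0}"
proof (intro equalityI subsetI)
  fix v assume "v \<in> normal_cone K x"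
  then have v: "inner v (u - x) \<le> 0" if "u \<in> K" for u
    using assms(2) that by (simp add: normal_cone_def)
  have "inner v x \<ge> 0" using v[OF polyhedral_cone_0[OF assms(1)]] by simp
  moreover have "inner v x \<le> 0" using v[OF polyhedral_cone_add[OF assms assms(2)]] by simp
  ultimately have "inner v x = 0" by simp
  moreover from this v have "v \<in> polar_cone K"
    by (auto simp: polar_cone_def inner_diff_right)
  ultimately show "v \<in> {v \<in> polar_cone K. inner v x = 0}" by simp
qed (use assms in \<open>auto simp: normal_cone_def polar_cone_def inner_diff_right\<close>)

section \<open>Points far out along a ray, and the cones \<open>add_line\<close>\<close>

lemma ray_enters_halfspaces:
  fixes F :: "'a::euclidean_space set"
  assumes "finite F"
  obtains s0 :: real where "0 \<le> s0"
    "\<And>s a b. \<lbrakk>s0 \<le> s; a \<in> F; inner a e < 0; norm b \<le> R\<rbrakk> \<Longrightarrow> inner a (s *\<^sub>R e + b) \<le> 0"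
proof -
  \<comment> \<open>By Cauchy-Schwarz, \<open>g a\<close> is a sufficient parameter for the
    constraint \<open>a\<close> when \<open>inner a e < 0\<close>; its values at other
    \<open>a\<close> can only enlarge the maximum. Inserting \<open>0\<close> covers empty
    \<open>F\<close>.\<close>
  define g where "g a = norm a * \<bar>R\<bar> / - inner a e" for a
  define s0 where "s0 = Max (insert 0 (g ` F))"
  have "0 \<le> s0" using assms by (simp add: s0_def)
  moreover have "inner a (s *\<^sub>R e + b) \<le> 0"
    if "s0 \<le> s" "a \<in> F" "inner a e < 0" "norm b \<le> R" for s a b
  proof -
    have "g a \<le> s0" using assms that(2) by (simp add: s0_def)
    then have "norm a * \<bar>R\<bar> / - inner a e \<le> s" using that(1) by (simp add: g_def)
    then have "norm a * \<bar>R\<bar> \<le> s * - inner a e"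
      using that(3) by (subst (asm) pos_divide_le_eq) auto
    moreover have "inner a b \<le> norm a * \<bar>R\<bar>"
    proof -
      have "inner a b \<le> norm a * norm b" by (rule norm_cauchy_schwarz)
      also have "\<dots> \<le> norm a * \<bar>R\<bar>" using that(4) by (intro mult_left_mono) auto
      finally show ?thesis .
    qed
    ultimately show ?thesis by (simp add: inner_add_right)
  qed
  ultimately show ?thesis by (rule that)
qed

text \<open>Far out along \<open>e\<close>, constraints with \<open>inner a e < 0\<close> hold
  uniformly for bounded \<open>b\<close>, and the others do not notice a step along
  \<open>e\<close>. The room for a step back later forces normals to be orthogonal to
  \<open>e\<close>.\<close>

lemma polyhedral_cone_recede:
  assumes "polyhedral_cone K" "e \<in> K"
  obtains s0 :: real where "0 \<le> s0"
    "\<And>s b. \<lbrakk>s0 \<le> s; norm b \<le> R; s *\<^sub>R e + b \<in> K\<rbrakk> \<Longrightarrow> s *\<^sub>R e + b - e \<in> K"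
proof -
  obtain F where F: "finite F" "K = {x. \<forall>a\<in>F. inner a x \<le> 0}"
    using assms(1) by (auto simp: polyhedral_cone_def)
  obtain s0 where s0: "0 \<le> s0"
    "\<And>s a b. \<lbrakk>s0 \<le> s; a \<in> F; inner a e < 0; norm b \<le> R\<rbrakk> \<Longrightarrow> inner a (s *\<^sub>R e + b) \<le> 0"
    using ray_enters_halfspaces[OF F(1), of e R] by metis
  \<comment> \<open>The extra \<open>1\<close> pays for the step back, which lowers the parameter to
    \<open>s - 1\<close>.\<close>
  have "s *\<^sub>R e + b - e \<in> K" if "s0 + 1 \<le> s" "norm b \<le> R" "s *\<^sub>R e + b \<in> K" for s b
  proof -
    have "inner a (s *\<^sub>R e + b - e) \<le> 0" if "a \<in> F" for a
    proof (cases "inner a e < 0")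
      case True
      have "inner a ((s - 1) *\<^sub>R e + b) \<le> 0"
        using s0(2)[of "s - 1" a b] that True \<open>s0 + 1 \<le> s\<close> \<open>norm b \<le> R\<close> by simp
      then show ?thesis by (simp add: algebra_simps)
    next
      case False
      then have "inner a e = 0" using assms(2) F(2) that by force
      then show ?thesis
        using \<open>s *\<^sub>R e + b \<in> K\<close> that F(2) by (auto simp: inner_diff_right)
    qed
    then show ?thesis using F(2) by simp
  qed
  with s0(1) show ?thesis by (intro that[of "s0 + 1"]) auto
qed

text \<open>Only the constraints active at \<open>e\<close> survive a long shift along
  \<open>e\<close>. Applied to \<open>K\<close> this describes \<open>add_line K e\<close>, applied
  to the polar it gives the polar of a face.\<close>

lemma polyhedral_cone_absorb:
  fixes F :: "'a::euclidean_space set"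
  assumes "finite F" "K = {x. \<forall>a\<in>F. inner a x \<le> 0}" "e \<in> K"
    and "\<And>a. \<lbrakk>a \<in> F; inner a e = 0\<rbrakk> \<Longrightarrow> inner a x \<le> 0"
  obtains s0 :: real where "0 \<le> s0" "\<And>s. s0 \<le> s \<Longrightarrow> s *\<^sub>R e + x \<in> K"
proof -
  obtain s0 where s0: "0 \<le> s0"
    "\<And>s a b. \<lbrakk>s0 \<le> s; a \<in> F; inner a e < 0; norm b \<le> norm x\<rbrakk> \<Longrightarrow> inner a (s *\<^sub>R e + b) \<le> 0"
    using ray_enters_halfspaces[OF assms(1), of e "norm x"] by metis
  have "inner a (s *\<^sub>R e + x) \<le> 0" if "s0 \<le> s" "a \<in> F" for s a
  proof (cases "inner a e < 0")
    case True
    then show ?thesis using s0(2) that by simp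
  next
    case False
    then have "inner a e = 0" using assms(2,3) that(2) by force
    then show ?thesis using assms(4) that(2) by (simp add: inner_add_right)
  qed
  with s0(1) show ?thesis using assms(2) by (intro that[of s0]) auto
qed

text \<open>For \<open>e \<in> K\<close> this is the cone \<open>K + \<real>e\<close>.\<close>

definition add_line :: "'a::euclidean_space set \<Rightarrow> 'a \<Rightarrow> 'a set" where
  "add_line K e = {x. \<exists>s\<ge>0. s *\<^sub>R e + x \<in> K}"

lemma subset_add_line: "K \<subseteq> add_line K e"
  unfolding add_line_def by (auto intro: exI[of _ 0])

lemma polyhedral_cone_add_line:
  assumes "polyhedral_cone K" "e \<in> K"
  shows "polyhedral_cone (add_line K e)"
proof -
  obtain F where F: "finite F" "K = {x. \<forall>a\<in>F. inner a x \<le> 0}"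
    using assms(1) by (auto simp: polyhedral_cone_def)
  have "add_line K e = {x. \<forall>a\<in>{a\<in>F. inner a e = 0}. inner a x \<le> 0}"
  proof (intro equalityI subsetI)
    fix x assume "x \<in> add_line K e"
    then show "x \<in> {x. \<forall>a\<in>{a\<in>F. inner a e = 0}. inner a x \<le> 0}"
      using F(2) by (force simp: add_line_def inner_add_right)
  next
    fix x assume "x \<in> {x. \<forall>a\<in>{a\<in>F. inner a e = 0}. inner a x \<le> 0}"
    then obtain s0 :: real where "0 \<le> s0" "\<And>s. s0 \<le> s \<Longrightarrow> s *\<^sub>R e + x \<in> K"
      using polyhedral_cone_absorb[OF F assms(2), of x] by auto
    then show "x \<in> add_line K e" by (auto simp: add_line_def)
  qed
  then show ?thesis
    unfolding polyhedral_cone_def using F(1)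
    by (intro exI[of _ "{a\<in>F. inner a e = 0}"]) auto
qed

text \<open>The enlarged cone contains \<open>- e\<close>, so its polar vectors must be orthogonal
  to \<open>e\<close>.\<close>

lemma polar_cone_add_line:
  assumes "polyhedral_cone K" "e \<in> K"
  shows "polar_cone (add_line K e) = {v \<in> polar_cone K. inner v e = 0}"
proof (intro equalityI subsetI)
  fix v assume v: "v \<in> polar_cone (add_line K e)"
  have "v \<in> polar_cone K"
    using v subset_add_line[of K e] by (auto simp: polar_cone_def)
  moreover have "- e \<in> add_line K e"
    using polyhedral_cone_0[OF assms(1)] by (auto simp: add_line_def intro!: exI[of _ 1])
  then have "inner v e \<ge> 0"
    using polar_cone_le[OF v, of "- e"] by simp
  ultimately show "v \<in> {v \<in> polar_cone K. inner v e = 0}"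
    using polar_cone_le[of v K e] assms(2) by auto
next
  fix v assume "v \<in> {v \<in> polar_cone K. inner v e = 0}"
  then show "v \<in> polar_cone (add_line K e)"
    by (force simp: polar_cone_def add_line_def inner_add_right)
qed

section \<open>Dimension drop, and regularity on tangent cones and faces\<close>

lemma dim_Int_orthogonal_less:
  fixes S :: "'a::euclidean_space set"
  assumes "T \<subseteq> span S" "\<And>x. x \<in> T \<Longrightarrow> inner q x = 0" "y \<in> S" "inner q y \<noteq> 0"
  shows "dim T < dim S"
proof (rule dim_psubset)
  have "span T \<subseteq> {x. inner q x = 0}"
    using assms(2) by (intro span_minimal subspace_hyperplane) auto
  moreover have "span T \<subseteq> span S"
    using assms(1) by (simp add: span_minimal)
  moreover have "y \<in> span S" using assms(3) by (rule span_base)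
  ultimately show "span T \<subset> span S" using assms(4) by blast
qed

text \<open>The graph of \<open>\<Phi>\<close> is a cone, so metric regularity near the origin amounts to the following
  global property, in which the normal vectors at \<open>x\<close> are written as the elements of the polar cone
  orthogonal to \<open>x\<close>.\<close>

definition regular_on :: "real \<Rightarrow> ('a::euclidean_space \<Rightarrow> 'a) \<Rightarrow> 'a set \<Rightarrow> bool" where
  "regular_on \<kappa> A K \<longleftrightarrow> (\<forall>x\<in>K. \<forall>v\<in>polar_cone K. \<forall>y. inner v x = 0 \<longrightarrow>
     (\<exists>u\<in>K. y - A u \<in> polar_cone K \<and> inner (y - A u) u = 0 \<and> norm (u - x) \<le> \<kappa> * norm (y - (A x + v))))"

lemma regular_onD:
  assumes "regular_on \<kappa> A K" "x \<in> K" "v \<in> polar_cone K" "inner v x = 0"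
  obtains u where "u \<in> K" "y - A u \<in> polar_cone K" "inner (y - A u) u = 0"
    "norm (u - x) \<le> \<kappa> * norm (y - (A x + v))"
  using assms unfolding regular_on_def by metis

text \<open>Far out along the ray through \<open>e\<close>, the cone \<open>K\<close> looks like \<open>add_line K e\<close>.\<close>

lemma regular_on_add_line:
  assumes K: "polyhedral_cone K" and lin: "linear A" and reg: "regular_on \<kappa> A K" and e: "e \<in> K"
  shows "regular_on \<kappa> A (add_line K e)"
  unfolding regular_on_def
proof (intro ballI allI impI)
  fix x v y
  assume x: "x \<in> add_line K e" and v: "v \<in> polar_cone (add_line K e)" and vx: "inner v x = 0"
  have v': "v \<in> polar_cone K" "inner v e = 0"
    using v polar_cone_add_line[OF K e] by auto
  obtain s1 where s1: "0 \<le> s1" "s1 *\<^sub>R e + x \<in> K"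
    using x by (auto simp: add_line_def)
  \<comment> \<open>\<open>r\<close> bounds the displacement that regularity will yield, so the
    threshold \<open>s0\<close> is fixed before the solution \<open>u\<close> is known.\<close>
  define r where "r = \<kappa> * norm (y - (A x + v))"
  obtain s0 where s0: "0 \<le> s0"
    "\<And>s b. \<lbrakk>s0 \<le> s; norm b \<le> norm x + r; s *\<^sub>R e + b \<in> K\<rbrakk> \<Longrightarrow> s *\<^sub>R e + b - e \<in> K"
    using polyhedral_cone_recede[OF K e, of "norm x + r"] by metis
  define s where "s = s0 + s1"
  have "s *\<^sub>R e + x = s0 *\<^sub>R e + (s1 *\<^sub>R e + x)" by (simp add: s_def scaleR_add_left)
  then have "s *\<^sub>R e + x \<in> K"
    using polyhedral_cone_add[OF K polyhedral_cone_scaleR[OF K e s0(1)] s1(2)] by metis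
  moreover have "inner v (s *\<^sub>R e + x) = 0" using v'(2) vx by (simp add: inner_add_right)
  \<comment> \<open>Moving the point by \<open>s\<close> times \<open>e\<close> and the target by
    \<open>s\<close> times \<open>A e\<close> leaves the residual unchanged.\<close>
  ultimately obtain u where u: "u \<in> K" "y + s *\<^sub>R A e - A u \<in> polar_cone K"
    "inner (y + s *\<^sub>R A e - A u) u = 0"
    "norm (u - (s *\<^sub>R e + x)) \<le> \<kappa> * norm (y + s *\<^sub>R A e - (A (s *\<^sub>R e + x) + v))"
    using regular_onD[OF reg _ v'(1)] by metis
  define b where "b = u - s *\<^sub>R e"
  have Ab: "A b = A u - s *\<^sub>R A e"
    using lin by (simp add: b_def linear_diff linear_scale)
  have bx: "norm (b - x) \<le> r"
    using u(4) lin by (simp add: b_def r_def linear_add linear_scale algebra_simps)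
  then have "norm b \<le> norm x + r"
    using norm_triangle_ineq2[of b x] by linarith
  then have "s *\<^sub>R e + b - e \<in> K"
    using s0(2)[of s b] u(1) s1(1) by (simp add: b_def s_def)
  \<comment> \<open>The normal at \<open>u\<close> is nonpositive on both \<open>e\<close> and
    \<open>u - e\<close> and vanishes on their sum, so it is orthogonal to \<open>e\<close>.\<close>
  then have "u - e \<in> K" by (simp add: b_def)
  then have "inner (y + s *\<^sub>R A e - A u) (u - e) \<le> 0"
    using polar_cone_le[OF u(2)] by simp
  moreover have "inner (y + s *\<^sub>R A e - A u) e \<le> 0"
    using polar_cone_le[OF u(2) e] .
  ultimately have "inner (y + s *\<^sub>R A e - A u) e = 0"
    using u(3) by (simp add: inner_diff_right)
  then have w: "inner (y - A b) e = 0" "y - A b \<in> polar_cone K" "inner (y - A b) u = 0"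
    using u(2,3) by (simp_all add: Ab algebra_simps)
  have "b \<in> add_line K e"
    using u(1) s0(1) s1(1) by (auto simp: add_line_def b_def s_def intro!: exI[of _ s])
  moreover have "y - A b \<in> polar_cone (add_line K e)"
    using w polar_cone_add_line[OF K e] by simp
  moreover have "inner (y - A b) b = 0"
    using w by (simp add: b_def inner_diff_right)
  ultimately show "\<exists>u\<in>add_line K e. y - A u \<in> polar_cone (add_line K e) \<and> inner (y - A u) u = 0 \<and>
      norm (u - x) \<le> \<kappa> * norm (y - (A x + v))"
    using bx by (auto simp: r_def)
qed

lemma polyhedral_cone_face:
  assumes "polyhedral_cone K" "q \<in> polar_cone K"
  shows "polyhedral_cone {x \<in> K. inner q x = 0}"
proof -
  obtain F where F: "finite F" "K = {x. \<forall>a\<in>F. inner a x \<le> 0}"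
    using assms(1) by (auto simp: polyhedral_cone_def)
  \<comment> \<open>The constraint \<open>- q\<close> supplies \<open>0 \<le> inner q x\<close>; the
    reverse inequality holds on all of \<open>K\<close>.\<close>
  have "{x \<in> K. inner q x = 0} = {x. \<forall>a\<in>insert (- q) F. inner a x \<le> 0}"
    using polar_cone_le[OF assms(2)] F(2) by (auto intro: antisym)
  then show ?thesis
    unfolding polyhedral_cone_def using F(1) by (intro exI[of _ "insert (- q) F"]) auto
qed

text \<open>Dual to \<open>polar_cone_add_line\<close>: constraints describing the polar have
  normals in \<open>K\<close> by the bipolar identity, and those orthogonal to \<open>q\<close> lie
  on the face.\<close>

lemma polar_cone_face:
  assumes "polyhedral_cone K" "q \<in> polar_cone K"
  shows "polar_cone {x \<in> K. inner q x = 0} = add_line (polar_cone K) q"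
proof (intro equalityI subsetI)
  fix v assume v: "v \<in> polar_cone {x \<in> K. inner q x = 0}"
  obtain H where H: "finite H" "polar_cone K = {x. \<forall>a\<in>H. inner a x \<le> 0}"
    "H \<subseteq> polar_cone (polar_cone K)"
    using polyhedral_cone_polar_cone[OF assms(1)] by (rule polyhedral_coneE)
  have "inner a v \<le> 0" if "a \<in> H" "inner a q = 0" for a
  proof -
    have "a \<in> K" using H(3) that(1) polar_polar_cone[OF assms(1)] by auto
    then show ?thesis
      using polar_cone_le[OF v, of a] that(2) by (simp add: inner_commute)
  qed
  then obtain s0 :: real where "0 \<le> s0" "\<And>s. s0 \<le> s \<Longrightarrow> s *\<^sub>R q + v \<in> polar_cone K"
    using polyhedral_cone_absorb[OF H(1,2) assms(2), of v] by auto
  then show "v \<in> add_line (polar_cone K) q" by (auto simp: add_line_def)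
next
  fix v assume "v \<in> add_line (polar_cone K) q"
  then show "v \<in> polar_cone {x \<in> K. inner q x = 0}"
    by (force simp: add_line_def polar_cone_def inner_add_left)
qed

text \<open>Dually to the previous lemma, the normal vector, not the point, is moved far
  out along a ray.\<close>

lemma regular_on_face:
  assumes K: "polyhedral_cone K" and reg: "regular_on \<kappa> A K" and lin: "linear A"
    and q: "q \<in> polar_cone K"
  shows "regular_on \<kappa> A {x \<in> K. inner q x = 0}"
  unfolding regular_on_def polar_cone_face[OF K q]
proof (intro ballI allI impI)
  fix x v y
  assume x: "x \<in> {x \<in> K. inner q x = 0}" and v: "v \<in> add_line (polar_cone K) q"
    and vx: "inner v x = 0"
  note K' = polyhedral_cone_polar_cone[OF K]
  obtain s1 where s1: "0 \<le> s1" "s1 *\<^sub>R q + v \<in> polar_cone K"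
    using v by (auto simp: add_line_def)
  define r where "r = \<kappa> * norm (y - (A x + v))"
  obtain B where B: "B > 0" "\<And>z. norm (A z) \<le> B * norm z"
    using linear_bounded_pos[OF lin] by blast
  \<comment> \<open>\<open>R\<close> bounds \<open>y - A u\<close> for every \<open>u\<close> within
    \<open>r\<close> of \<open>x\<close>.\<close>
  define R where "R = norm y + B * (norm x + r)"
  obtain s0 where s0: "0 \<le> s0"
    "\<And>s b. \<lbrakk>s0 \<le> s; norm b \<le> R; s *\<^sub>R q + b \<in> polar_cone K\<rbrakk> \<Longrightarrow> s *\<^sub>R q + b - q \<in> polar_cone K"
    using polyhedral_cone_recede[OF K' q, of R] by metis
  define s where "s = s0 + s1"
  have "s *\<^sub>R q + v = s0 *\<^sub>R q + (s1 *\<^sub>R q + v)" by (simp add: s_def scaleR_add_left)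
  then have "s *\<^sub>R q + v \<in> polar_cone K"
    using polyhedral_cone_add[OF K' polyhedral_cone_scaleR[OF K' q s0(1)] s1(2)] by metis
  moreover have "inner (s *\<^sub>R q + v) x = 0" using x vx by (simp add: inner_add_left)
  ultimately obtain u where u: "u \<in> K" "y + s *\<^sub>R q - A u \<in> polar_cone K"
    "inner (y + s *\<^sub>R q - A u) u = 0"
    "norm (u - x) \<le> \<kappa> * norm (y + s *\<^sub>R q - (A x + (s *\<^sub>R q + v)))"
    using regular_onD[OF reg, of x "s *\<^sub>R q + v" "y + s *\<^sub>R q"] x by auto
  have ux: "norm (u - x) \<le> r" using u(4) by (simp add: r_def algebra_simps)
  then have "norm u \<le> norm x + r"
    using norm_triangle_ineq2[of u x] by linarith
  then have "norm (A u) \<le> B * (norm x + r)"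
    using B(2)[of u] B(1) by (meson mult_left_mono less_imp_le order_trans)
  then have "norm (y - A u) \<le> R"
    using norm_triangle_ineq4[of y "A u"] by (simp add: R_def)
  moreover have eq: "s *\<^sub>R q + (y - A u) = y + s *\<^sub>R q - A u" by simp
  ultimately have "y + s *\<^sub>R q - A u - q \<in> polar_cone K"
    using s0(2)[of s "y - A u"] u(2) s1(1) unfolding eq by (simp add: s_def)
  \<comment> \<open>The normal minus \<open>q\<close> is still polar, so \<open>inner q u\<close>
    cannot be negative and \<open>u\<close> lies on the face.\<close>
  then have "inner (y + s *\<^sub>R q - A u - q) u \<le> 0"
    using u(1) by (rule polar_cone_le)
  then have qu: "inner q u = 0"
    using u(3) polar_cone_le[OF q u(1)] by (simp add: inner_diff_left)
  moreover have "inner (y - A u) u = 0"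
    using u(3) qu by (simp add: inner_diff_left inner_add_left)
  moreover have "y - A u \<in> add_line (polar_cone K) q"
  proof -
    have "s *\<^sub>R q + (y - A u) \<in> polar_cone K" unfolding eq by (rule u(2))
    then show ?thesis
      unfolding add_line_def using s0(1) s1(1) s_def by (metis (mono_tags) CollectI add_nonneg_nonneg)
  qed
  ultimately show "\<exists>u\<in>{x \<in> K. inner q x = 0}. y - A u \<in> add_line (polar_cone K) q \<and>
      inner (y - A u) u = 0 \<and> norm (u - x) \<le> \<kappa> * norm (y - (A x + v))"
    using u(1) ux by (auto simp: r_def)
qed

section \<open>Subspaces, and rays leaving a cone\<close>

text \<open>Solvability for every \<open>y\<close> makes the image of \<open>K\<close> and the
  orthogonal complement \<open>P\<close> span the space. If \<open>x \<noteq> 0\<close> had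
  \<open>A x\<close> in \<open>P\<close>, the smaller subspace \<open>X\<close> would suffice in
  place of \<open>K\<close>, against \<open>dim P + dim K = DIM('a)\<close>.\<close>

lemma regular_on_subspace_kernel:
  fixes K :: "'a::euclidean_space set"
  assumes K: "subspace K" and lin: "linear A" and reg: "regular_on \<kappa> A K"
    and x: "x \<in> K" "\<And>k. k \<in> K \<Longrightarrow> inner (A x) k = 0"
  shows "x = 0"
proof (rule ccontr)
  assume "x \<noteq> 0"
  define P where "P = {y. \<forall>k\<in>K. orthogonal k y}"
  define X where "X = {k\<in>K. inner x k = 0}"
  have P: "subspace P" unfolding P_def by (rule subspace_orthogonal_to_vectors)
  have X: "subspace X"
    using K unfolding X_def by (auto simp: subspace_def inner_add_right)
  have polar: "v \<in> P" if "v \<in> polar_cone K" for v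
  proof -
    have "inner v k = 0" if "k \<in> K" for k
      using polar_cone_le[OF \<open>v \<in> polar_cone K\<close> that]
        polar_cone_le[OF \<open>v \<in> polar_cone K\<close> subspace_neg[OF K that]] by simp
    then show ?thesis by (simp add: P_def orthogonal_def inner_commute)
  qed
  have "y \<in> {a + b |a b. a \<in> A ` X \<and> b \<in> P}" for y
  proof -
    obtain u where u: "u \<in> K" "y - A u \<in> polar_cone K"
      using regular_onD[OF reg, of 0 0 y] subspace_0[OF K] by (auto simp: polar_cone_def)
    \<comment> \<open>The component of \<open>u\<close> along \<open>x\<close> is moved into the
      summand from \<open>P\<close>.\<close>
    define c where "c = inner x u / inner x x"
    have "u - c *\<^sub>R x \<in> X"
      using u(1) x(1) K \<open>x \<noteq> 0\<close>
      by (simp add: X_def subspace_diff subspace_scale inner_diff_right c_def)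
    moreover have "c *\<^sub>R A x \<in> P"
      using x(2) by (simp add: P_def orthogonal_def inner_commute)
    then have "y - A u + c *\<^sub>R A x \<in> P"
      using polar[OF u(2)] P by (simp add: subspace_add)
    moreover have "y = A (u - c *\<^sub>R x) + (y - A u + c *\<^sub>R A x)"
      using lin by (simp add: linear_diff linear_scale)
    ultimately show ?thesis
      by (intro CollectI exI[of _ "A (u - c *\<^sub>R x)"] exI[of _ "y - A u + c *\<^sub>R A x"] conjI imageI)
  qed
  then have "{a + b |a b. a \<in> A ` X \<and> b \<in> P} = UNIV"
    by (intro equalityI subset_UNIV subsetI)
  then have "DIM('a) \<le> dim (A ` X) + dim P"
    using dim_sums_Int[OF linear_subspace_image[OF lin X] P] by simp
  moreover have "dim (A ` X) \<le> dim X" using lin by (rule dim_image_le)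
  moreover have "dim X < dim K"
  proof (rule dim_Int_orthogonal_less)
    show "X \<subseteq> span K" by (auto simp: X_def intro: span_base)
    show "inner x k = 0" if "k \<in> X" for k using that by (simp add: X_def)
    show "inner x x \<noteq> 0" using \<open>x \<noteq> 0\<close> by simp
  qed (rule x(1))
  moreover have "dim P + dim K = DIM('a)"
    using dim_subspace_orthogonal_to_vectors[OF K subspace_UNIV] by (simp add: P_def)
  ultimately show False by linarith
qed

text \<open>Orthogonality puts \<open>- k\<close> in the bipolar, which is \<open>K\<close>.\<close>

lemma subspace_polyhedral_cone:
  assumes "polyhedral_cone K" "\<And>q k. q \<in> polar_cone K \<Longrightarrow> k \<in> K \<Longrightarrow> inner q k = 0"
  shows "subspace K"
proof -
  have "- k \<in> K" if "k \<in> K" for k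
    using assms(2)[OF _ that] polar_polar_cone[OF assms(1)]
    by (auto simp: polar_cone_def inner_commute)
  moreover have "convex_cone K"
    using polyhedral_cone_add[OF assms(1)] polyhedral_cone_scaleR[OF assms(1)]
      polyhedral_cone_0[OF assms(1)] by (auto simp: convex_cone_iff)
  ultimately show ?thesis by (simp add: subspace_convex_cone_symmetric)
qed

lemma polyhedral_cone_exit:
  assumes "polyhedral_cone K" "x \<in> K" "u \<in> K" "- u \<notin> K"
  obtains t q where "0 \<le> t" "x - t *\<^sub>R u \<in> K" "q \<in> polar_cone K"
    "inner q (x - t *\<^sub>R u) = 0" "inner q u \<noteq> 0"
proof -
  obtain F where F: "finite F" "K = {x. \<forall>a\<in>F. inner a x \<le> 0}" "F \<subseteq> polar_cone K"
    using assms(1) by (rule polyhedral_coneE)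
  \<comment> \<open>A ratio test: only constraints in \<open>G\<close> tighten along
    \<open>- u\<close>, \<open>g a\<close> is the parameter at which \<open>a\<close> becomes
    active, and the minimizer \<open>q\<close> is hit first.\<close>
  define G where "G = {a\<in>F. inner a u < 0}"
  define g where "g a = inner a x / inner a u" for a
  have "G \<noteq> {}" "finite G" using assms(4) F(1,2) by (auto simp: G_def)
  then obtain q where q: "q \<in> G" "\<And>a. a \<in> G \<Longrightarrow> g q \<le> g a"
    using ex_min_if_finite[of "g ` G"] by (metis arg_min_if_finite(1) arg_min_least)
  have "0 \<le> g q"
    using q(1) assms(2) F(2) by (auto simp: g_def G_def divide_nonpos_neg)
  moreover have "inner a (x - g q *\<^sub>R u) \<le> 0" if "a \<in> F" for a
  proof (cases "a \<in> G")
    case True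
    then have "g q * inner a u \<ge> inner a x"
      using q(2)[of a] by (auto simp: g_def[of a] G_def neg_le_divide_eq)
    then show ?thesis by (simp add: inner_diff_right)
  next
    case False
    then have "inner a u = 0" using that assms(3) F(2) by (force simp: G_def)
    then show ?thesis using that assms(2) F(2) by (simp add: inner_diff_right)
  qed
  moreover have "inner q (x - g q *\<^sub>R u) = 0" "inner q u \<noteq> 0" "q \<in> polar_cone K"
    using q(1) F(3) by (auto simp: inner_diff_right g_def G_def)
  ultimately show ?thesis using F(2) by (intro that[of "g q" q]) auto
qed

section \<open>The induction on dimensions\<close>

lemma regular_on_imp_trivial:
  assumes "polyhedral_cone K" "linear A" "regular_on \<kappa> A K" "x \<in> K" "A x \<in> polar_cone K"
  shows "x = 0"
  using assms
\<comment> \<open>\<open>x\<close> is generalized because the hypothesis is also applied to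
  \<open>- u\<close> and to an exit point of a ray.\<close>
proof (induction "dim K + dim (polar_cone K)" arbitrary: K x rule: less_induct)
  case less
  note K = less.prems(1) and lin = less.prems(2) and reg = less.prems(3)
  note K' = polyhedral_cone_polar_cone[OF K]
  \<comment> \<open>Otherwise \<open>p\<close> lies on a proper face, whose polar contains that of
    \<open>K\<close> and hence \<open>A p\<close>; the induction hypothesis gives
    \<open>p = 0\<close>.\<close>
  have face: "inner q k = 0"
    if p: "p \<in> K" "A p \<in> polar_cone K" "p \<noteq> 0"
      and q: "q \<in> polar_cone K" "inner q p = 0" and k: "k \<in> K" for p q k
  proof (rule ccontr)
    assume "inner q k \<noteq> 0"
    let ?G = "{x \<in> K. inner q x = 0}"
    have "dim ?G < dim K"
      using \<open>inner q k \<noteq> 0\<close> k by (intro dim_Int_orthogonal_less[of _ _ q k]) (auto simp: span_base)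
    moreover have "polar_cone ?G \<subseteq> span (polar_cone K)"
    proof
      fix v assume "v \<in> polar_cone ?G"
      then obtain s where "s *\<^sub>R q + v \<in> polar_cone K"
        by (auto simp: polar_cone_face[OF K q(1)] add_line_def)
      then have "(s *\<^sub>R q + v) - s *\<^sub>R q \<in> span (polar_cone K)"
        using q(1) by (intro span_diff span_scale) (auto intro: span_base)
      then show "v \<in> span (polar_cone K)" by simp
    qed
    then have "dim (polar_cone ?G) \<le> dim (polar_cone K)"
      by (metis dim_span dim_subset)
    ultimately have "dim ?G + dim (polar_cone ?G) < dim K + dim (polar_cone K)" by linarith
    moreover have "A p \<in> polar_cone ?G"
      using p(2) by (auto simp: polar_cone_def)
    ultimately have "p = 0"
      using less.hyps polyhedral_cone_face[OF K q(1)] lin regular_on_face[OF K reg lin q(1)] p(1) q(2)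
      by blast
    with p(3) show False by simp
  qed
  \<comment> \<open>Otherwise \<open>add_line K e\<close> has a polar of smaller dimension that
    still contains \<open>A p\<close>, so again \<open>p = 0\<close>.\<close>
  have line: "inner q e = 0"
    if p: "p \<in> K" "A p \<in> polar_cone K" "p \<noteq> 0"
      and e: "e \<in> K" "inner (A p) e = 0" and q: "q \<in> polar_cone K" for p q e
  proof (rule ccontr)
    assume "inner q e \<noteq> 0"
    let ?T = "add_line K e"
    have polar: "polar_cone ?T = {v \<in> polar_cone K. inner v e = 0}"
      using polar_cone_add_line[OF K e(1)] .
    then have "dim (polar_cone ?T) < dim (polar_cone K)"
      using \<open>inner q e \<noteq> 0\<close> q
      by (intro dim_Int_orthogonal_less[of _ _ e q]) (auto simp: span_base inner_commute)
    moreover have "?T \<subseteq> span K"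
    proof
      fix v assume "v \<in> ?T"
      then obtain s where "s *\<^sub>R e + v \<in> K" by (auto simp: add_line_def)
      then have "(s *\<^sub>R e + v) - s *\<^sub>R e \<in> span K"
        using e(1) by (intro span_diff span_scale) (auto intro: span_base)
      then show "v \<in> span K" by simp
    qed
    then have "dim ?T \<le> dim K"
      by (metis dim_span dim_subset)
    ultimately have "dim ?T + dim (polar_cone ?T) < dim K + dim (polar_cone K)" by linarith
    moreover have "A p \<in> polar_cone ?T" using p(2) e(2) polar by simp
    moreover have "p \<in> ?T" using p(1) subset_add_line by blast
    ultimately have "p = 0"
      using less.hyps polyhedral_cone_add_line[OF K e(1)] lin regular_on_add_line[OF K lin reg e(1)]
      by blast
    with p(3) show False by simp
  qed
  show "x = 0"
  proof (rule ccontr)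
    assume x0: "x \<noteq> 0"
    note x = less.prems(4,5) x0
    obtain z where z: "z \<in> K" "- A x - A z \<in> polar_cone K"
      using regular_onD[OF reg polyhedral_cone_0[OF K] polyhedral_cone_0[OF K'], of "- A x"] by auto
    define u where "u = x + z"
    have u: "u \<in> K" using polyhedral_cone_add[OF K x(1) z(1)] by (simp add: u_def)
    have Au: "- A u \<in> polar_cone K"
      using z(2) lin by (simp add: u_def linear_add)
    have "inner q k = 0" if q: "q \<in> polar_cone K" and k: "k \<in> K" for q k
    proof -
      have zero: "inner q w = 0" if "w \<in> K" "- w \<in> K" for w
        using polar_cone_le[OF q that(1)] polar_cone_le[OF q that(2)] by simp
      consider "u = 0" | "u \<noteq> 0" "- u \<in> K" | "- u \<notin> K" by blast
      then show ?thesis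
      proof cases
        \<comment> \<open>Here \<open>- x\<close> lies in \<open>K\<close>, so \<open>q\<close> is
          orthogonal to \<open>x\<close> and \<open>face\<close> applies to
          \<open>x\<close>.\<close>
        case 1
        then have "z = - x" by (simp add: u_def add_eq_0_iff)
        then show ?thesis using face[OF x q zero[OF x(1)] k] z(1) by simp
      next
        \<comment> \<open>Now \<open>- u\<close> is a nonzero point of \<open>K\<close> with polar
          image, orthogonal to \<open>q\<close>.\<close>
        case 2
        then show ?thesis
          using face[of "- u" q k] q k Au zero[OF u] lin by (simp add: linear_neg)
      next
        case 3
        then obtain t a where t: "0 \<le> t" "x - t *\<^sub>R u \<in> K" "a \<in> polar_cone K"
          "inner a (x - t *\<^sub>R u) = 0" "inner a u \<noteq> 0"
          using polyhedral_cone_exit[OF K x(1) u] by metis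
        have "A (x - t *\<^sub>R u) = A x + t *\<^sub>R (- A u)"
          using lin by (simp add: linear_diff linear_scale)
        then have "A (x - t *\<^sub>R u) \<in> polar_cone K"
          using polyhedral_cone_add[OF K' x(2) polyhedral_cone_scaleR[OF K' Au t(1)]] by simp
        \<comment> \<open>The exit point is on the face cut out by \<open>a\<close>, which is proper
          as \<open>inner a u \<noteq> 0\<close>; by \<open>face\<close> it is the origin.\<close>
        then have "x - t *\<^sub>R u = 0"
          using face[OF t(2) _ _ t(3,4) u] t(5) by blast
        then have xt: "x = t *\<^sub>R u" by simp
        \<comment> \<open>As a nonnegative multiple of \<open>A u\<close>, \<open>A x\<close> is
          nonnegative on \<open>K\<close>; being polar it is also nonpositive.\<close>
        have "inner (A x) k = t * inner (A u) k"
          by (subst xt) (use lin in \<open>simp add: linear_scale\<close>)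
        moreover have "inner (A u) k \<ge> 0"
          using polar_cone_le[OF Au k] by simp
        ultimately have "inner (A x) k = 0"
          using t(1) polar_cone_le[OF x(2) k] by (metis antisym mult_nonneg_nonneg)
        then show ?thesis using line[OF x k _ q] by blast
      qed
    qed
    then have "subspace K" "\<And>k. k \<in> K \<Longrightarrow> inner (A x) k = 0"
      using subspace_polyhedral_cone[OF K] x(2) by auto
    then show False
      using regular_on_subspace_kernel[OF _ lin reg x(1)] x0 by blast
  qed
qed

section \<open>From local metric regularity to the global property\<close>

text \<open>Arbitrary data are scaled into the \<open>\<epsilon>\<close>-ball and the solution is
  scaled back. Doubling the modulus yields an actual solution without attainment of the
  infimum.\<close>

lemma metrically_regular_imp_regular_on:
  fixes K :: "'a::euclidean_space set"
  assumes K: "polyhedral_cone K" and lin: "linear A"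
    and \<Phi>: "\<And>x. \<Phi> x = (\<lambda>v. A x + v) ` normal_cone K x"
    and pos: "\<kappa> > 0" "\<epsilon> > 0"
    and mr: "\<And>x y. \<lbrakk>norm x < \<epsilon>; norm y < \<epsilon>\<rbrakk> \<Longrightarrow>
            set_dist x {u. y \<in> \<Phi> u} \<le> ereal \<kappa> * set_dist y (\<Phi> x)"
  shows "regular_on (2 * \<kappa>) A K"
  unfolding regular_on_def
proof (intro ballI allI impI)
  fix x v y assume x: "x \<in> K" and v: "v \<in> polar_cone K" and vx: "inner v x = 0"
  note K' = polyhedral_cone_polar_cone[OF K]
  have \<Phi>_iff: "w \<in> \<Phi> u \<longleftrightarrow> u \<in> K \<and> w - A u \<in> polar_cone K \<and> inner (w - A u) u = 0" for w u
  proof (cases "u \<in> K")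
    case True
    have "w \<in> \<Phi> u \<longleftrightarrow> w - A u \<in> normal_cone K u"
      unfolding \<Phi> by (auto intro: image_eqI[of _ _ "w - A u"])
    with True show ?thesis using normal_cone_eq_polar_cone[OF K] by auto
  qed (simp add: \<Phi> normal_cone_def)
  let ?goal = "\<exists>u\<in>K. y - A u \<in> polar_cone K \<and> inner (y - A u) u = 0 \<and>
    norm (u - x) \<le> 2 * \<kappa> * norm (y - (A x + v))"
  show ?goal
  proof (cases "y = A x + v")
    case True
    then show ?thesis using x v vx by (intro bexI[of _ x]) auto
  next
    case False
    define d where "d = norm (y - (A x + v))"
    have "d > 0" using False by (simp add: d_def)
    define c where "c = \<epsilon> / (norm x + norm y + 1)"
    have n: "0 < norm x + norm y + 1" by (smt (verit) norm_ge_zero)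
    then have c: "0 < c" using pos by (simp add: c_def)
    have ce: "c * (norm x + norm y + 1) = \<epsilon>" using n by (simp add: c_def)
    have "c * norm x < \<epsilon>" "c * norm y < \<epsilon>"
      unfolding ce[symmetric] using c by (auto simp: add_nonneg_pos add_pos_nonneg intro!: mult_strict_left_mono)
    then have small: "norm (c *\<^sub>R x) < \<epsilon>" "norm (c *\<^sub>R y) < \<epsilon>" using c by auto
    define U where "U = {u. c *\<^sub>R y \<in> \<Phi> u}"
    have mem: "c *\<^sub>R (A x + v) \<in> \<Phi> (c *\<^sub>R x)"
      using polyhedral_cone_scaleR[OF K x] polyhedral_cone_scaleR[OF K' v] c lin vx
      by (simp add: \<Phi>_iff linear_scale scaleR_add_right)
    have "infdist (c *\<^sub>R y) (\<Phi> (c *\<^sub>R x)) \<le> dist (c *\<^sub>R y) (c *\<^sub>R (A x + v))"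
      using mem by (rule infdist_le)
    also have "\<dots> = c * d"
      using c by (simp add: dist_norm d_def flip: scaleR_diff_right)
    finally have le: "infdist (c *\<^sub>R y) (\<Phi> (c *\<^sub>R x)) \<le> c * d" .
    have "set_dist (c *\<^sub>R x) U \<le> ereal \<kappa> * set_dist (c *\<^sub>R y) (\<Phi> (c *\<^sub>R x))"
      unfolding U_def using small by (rule mr)
    also have "\<dots> = ereal (\<kappa> * infdist (c *\<^sub>R y) (\<Phi> (c *\<^sub>R x)))"
      using mem by (auto simp: set_dist_def)
    also have "\<dots> \<le> ereal (\<kappa> * (c * d))"
      using le pos by simp
    finally have dist_le: "set_dist (c *\<^sub>R x) U \<le> ereal (\<kappa> * (c * d))" .
    \<comment> \<open>A finite bound excludes the empty set, whose distance is infinite.\<close>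
    then have ne: "U \<noteq> {}" by (auto simp: set_dist_def)
    have "infdist (c *\<^sub>R x) U \<le> \<kappa> * (c * d)"
      using dist_le ne by (simp add: set_dist_def)
    \<comment> \<open>Strictness rests on \<open>d > 0\<close>, hence the separate case
      \<open>y = A x + v\<close>.\<close>
    also have "\<dots> < 2 * \<kappa> * (c * d)"
      using pos c \<open>d > 0\<close> by simp
    finally obtain u where u: "u \<in> U" "dist (c *\<^sub>R x) u < 2 * \<kappa> * (c * d)"
      using ne by (auto simp: infdist_def cInf_less_iff)
    define w where "w = inverse c *\<^sub>R u"
    have u_eq: "u = c *\<^sub>R w" using c by (simp add: w_def)
    have \<open>c *\<^sub>R y - A u = c *\<^sub>R (y - A w)\<close>
      using lin by (simp add: u_eq linear_scale scaleR_diff_right)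
    then have cw: "u \<in> K" "c *\<^sub>R (y - A w) \<in> polar_cone K" "inner (c *\<^sub>R (y - A w)) u = 0"
      using u(1) by (auto simp: U_def \<Phi>_iff)
    have "w \<in> K"
      using polyhedral_cone_scaleR[OF K cw(1), of "inverse c"] c by (simp add: w_def)
    moreover have "y - A w \<in> polar_cone K"
      using polyhedral_cone_scaleR[OF K' cw(2), of "inverse c"] c by simp
    moreover have "inner (y - A w) w = 0"
      using cw(3) c by (simp add: u_eq)
    moreover have "norm (w - x) \<le> 2 * \<kappa> * d"
    proof -
      have "c * norm (w - x) = dist (c *\<^sub>R x) u"
        using c by (simp add: u_eq dist_norm norm_minus_commute flip: scaleR_diff_right)
      also have "\<dots> \<le> c * (2 * \<kappa> * d)" using u(2) by (simp add: algebra_simps)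
      finally show ?thesis using c by simp
    qed
    ultimately show ?thesis by (auto simp: d_def)
  qed
qed

theorem mainTheorem13:
  fixes K :: "'a::euclidean_space set" and A :: "'a \<Rightarrow> 'a"
    and \<Phi> :: "'a \<Rightarrow> 'a set"
  assumes "polyhedral_cone K"
    and "linear A"
    and "\<And>x. \<Phi> x = (\<lambda>v. A x + v) ` normal_cone K x"
    and "\<exists>\<kappa>>0. \<exists>\<epsilon>>0. \<forall>x y. norm x < \<epsilon> \<and> norm y < \<epsilon> \<longrightarrow>
            set_dist x {u. y \<in> \<Phi> u} \<le> ereal \<kappa> * set_dist y (\<Phi> x)"
  shows "A ` K \<inter> polar_cone K = {0}"
proof -
  obtain \<kappa> where "regular_on \<kappa> A K"
    using assms(4) metrically_regular_imp_regular_on[OF assms(1-3)] by blast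
  then have "x = 0" if "x \<in> K" "A x \<in> polar_cone K" for x
    using regular_on_imp_trivial assms(1,2) that by blast
  moreover have "0 \<in> K" "0 \<in> polar_cone K" "A 0 = 0"
    using polyhedral_cone_0[OF assms(1)] linear_0[OF assms(2)] by (auto simp: polar_cone_def)
  ultimately show ?thesis by (auto intro: image_eqI[of _ _ 0])
qed

end
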